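(* Let $\lambda,\kappa$ be cardinals with $\mathrm{cf}(\kappa)>\omega$, and let $\bar A=\langle A_\sigma:\sigma\in 2^{<\omega}\rangle$ and $\bar B=\langle B_\sigma:\sigma\in 2^{<\omega}\rangle$ be nice sequences of representatives for countable atomless Boolean subalgebras of $\mathcal{P}(\lambda)/\mathcal{I}_\kappa$. Then the following are equivalent: (1) there is a trivial isomorphism from $\mathcal{P}(A_\emptyset)/\mathcal{I}_\kappa$ to $\mathcal{P}(B_\emptyset)/\mathcal{I}_\kappa$ sending $[A_\sigma]$ to $[B_\sigma]$ for every $\sigma\in 2^{<\omega}$; (2) $|X(\bar A)\triangle X(\bar B)|<\kappa$, and there is $S\subseteq\lambda$ with $|S|<\kappa$ such that $|A_x\setminus S|=|B_x\setminus S|$ for all $x\in 2^\omega$.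
   Context: $\mathcal{I}_\kappa$ is the ideal of sets of cardinality less than $\kappa$ (on the relevant set). A sequence $\bar A$ of subsets of $\lambda$ is a nice sequence of representatives for a countable atomless subalgebra $\mathcal{A}$ if for each $\sigma$, $A_{\sigma^\frown0},A_{\sigma^\frown1}$ partition $A_\sigma$, and the classes $[A_\sigma]$ generate $\mathcal{A}$. For $x\in 2^\omega$, $A_x=\bigcap\{A_\sigma:\sigma\subset x\}$ and $X(\bar A)=\{x\in 2^\omega:A_x\neq\emptyset\}$. An isomorphism $\pi:\mathcal{P}(X)/\mathcal{I}_\kappa\to\mathcal{P}(Y)/\mathcal{I}_\kappa$ is trivial if there is $f:Y\to X$ (possibly defined only on a subset of $Y$ with complement of size $<\kappa$) with $\pi([C])=[f^{-1}(C)]$ for all $C\subseteq X$. *)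

theory Defs
  imports Complex_Main "HOL-Library.Countable_Set"
begin

unbundle cardinal_syntax

text \<open>
  Cardinals are well-order relations \<open>r\<close> with \<open>Card_order r\<close>; a cardinal, viewed as a set, is
  \<open>Field r\<close>. The library predicate \<^const>\<open>cofinal\<close> asks for strictly larger elements, so that a
  successor ordinal has no cofinal subset at all; cofinality is therefore based on the usual
  non-strict notion.
\<close>

definition unbounded_in :: "'a set \<Rightarrow> 'a rel \<Rightarrow> bool" where
  "unbounded_in A r \<longleftrightarrow> A \<subseteq> Field r \<and> (\<forall>a \<in> Field r. \<exists>b \<in> A. (a, b) \<in> r)"

definition cf :: "'a rel \<Rightarrow> 'a rel" where
  "cf r = |SOME A. unbounded_in A r \<and> (\<forall>B. unbounded_in B r \<longrightarrow> |A| \<le>o |B| )|"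


record 'b balg =
  bcarrier :: "'b set"
  bmeet :: "'b \<Rightarrow> 'b \<Rightarrow> 'b"
  bjoin :: "'b \<Rightarrow> 'b \<Rightarrow> 'b"
  bcompl :: "'b \<Rightarrow> 'b"
  bzero :: 'b
  bone :: 'b

definition bsubalgebra :: "'b balg \<Rightarrow> 'b set \<Rightarrow> bool" where
  "bsubalgebra P \<A> \<longleftrightarrow> \<A> \<subseteq> bcarrier P \<and> bzero P \<in> \<A> \<and> bone P \<in> \<A> \<and>
     (\<forall>a\<in>\<A>. \<forall>b\<in>\<A>. bmeet P a b \<in> \<A> \<and> bjoin P a b \<in> \<A>) \<and> (\<forall>a\<in>\<A>. bcompl P a \<in> \<A>)"

definition bgenerates :: "'b balg \<Rightarrow> 'b set \<Rightarrow> 'b set \<Rightarrow> bool" where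
  "bgenerates P G \<A> \<longleftrightarrow> bsubalgebra P hull G = \<A>"

definition batom :: "'b balg \<Rightarrow> 'b set \<Rightarrow> 'b \<Rightarrow> bool" where
  "batom P \<A> a \<longleftrightarrow> a \<in> \<A> \<and> a \<noteq> bzero P \<and>
     (\<forall>b\<in>\<A>. bmeet P b a = b \<longrightarrow> b = bzero P \<or> b = a)"

definition batomless :: "'b balg \<Rightarrow> 'b set \<Rightarrow> bool" where
  "batomless P \<A> \<longleftrightarrow> (\<forall>a. \<not> batom P \<A> a)"

definition biso :: "'b balg \<Rightarrow> 'c balg \<Rightarrow> ('b \<Rightarrow> 'c) \<Rightarrow> bool" where
  "biso P Q \<pi> \<longleftrightarrow> bij_betw \<pi> (bcarrier P) (bcarrier Q) \<and>
     \<pi> (bzero P) = bzero Q \<and> \<pi> (bone P) = bone Q \<and>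
     (\<forall>a\<in>bcarrier P. \<pi> (bcompl P a) = bcompl Q (\<pi> a)) \<and>
     (\<forall>a\<in>bcarrier P. \<forall>b\<in>bcarrier P.
        \<pi> (bmeet P a b) = bmeet Q (\<pi> a) (\<pi> b) \<and> \<pi> (bjoin P a b) = bjoin Q (\<pi> a) (\<pi> b))"


definition small_ideal :: "'k rel \<Rightarrow> 'a set \<Rightarrow> 'a set set" where
  "small_ideal \<kappa> X = {C. C \<subseteq> X \<and> |C| <o \<kappa>}"

definition mod_small :: "'k rel \<Rightarrow> 'a set \<Rightarrow> 'a set rel" where
  "mod_small \<kappa> X = {(C, D). C \<subseteq> X \<and> D \<subseteq> X \<and> sym_diff C D \<in> small_ideal \<kappa> X}"

definition cls :: "'k rel \<Rightarrow> 'a set \<Rightarrow> 'a set \<Rightarrow> 'a set set" where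
  "cls \<kappa> X C = mod_small \<kappa> X `` {C}"

text \<open>
  The algebra \<open>P(X) / I\<^sub>\<kappa>\<close>. The operations act on classes through representatives, by the
  union-over-representatives construction; for infinite \<open>\<kappa>\<close> the result does not depend on the
  representatives, as shown in \<open>cls_ops\<close>.
\<close>

definition pow_mod :: "'k rel \<Rightarrow> 'a set \<Rightarrow> 'a set set balg" where
  "pow_mod \<kappa> X = \<lparr>
     bcarrier = Pow X // mod_small \<kappa> X,
     bmeet = (\<lambda>a b. \<Union>C\<in>a. \<Union>D\<in>b. cls \<kappa> X (C \<inter> D)),
     bjoin = (\<lambda>a b. \<Union>C\<in>a. \<Union>D\<in>b. cls \<kappa> X (C \<union> D)),
     bcompl = (\<lambda>a. \<Union>C\<in>a. cls \<kappa> X (X - C)),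
     bzero = cls \<kappa> X {},
     bone = cls \<kappa> X X\<rparr>"

lemma small_Un:
  assumes "Cinfinite \<kappa>" "|A| <o \<kappa>" "|B| <o \<kappa>"
  shows "|A \<union> B| <o \<kappa>"
  using assms card_of_Un_ordLess_infinite_Field[of \<kappa> A B] by (auto simp: cinfinite_def)

lemma small_subset: "|B| <o \<kappa> \<Longrightarrow> A \<subseteq> B \<Longrightarrow> |A| <o \<kappa>"
  using card_of_mono1 ordLeq_ordLess_trans by blast

lemma mod_small_iff: "(C, D) \<in> mod_small \<kappa> X \<longleftrightarrow> C \<subseteq> X \<and> D \<subseteq> X \<and> |sym_diff C D| <o \<kappa>"
  by (auto simp: mod_small_def small_ideal_def)

lemma equiv_mod_small:
  fixes X :: "'a set"
  assumes "Cinfinite \<kappa>"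
  shows "equiv (Pow X) (mod_small \<kappa> X)"
proof (rule equivI)
  show "mod_small \<kappa> X \<subseteq> Pow X \<times> Pow X"
    by (auto simp: mod_small_iff)
  have "|{} :: 'a set| <o \<kappa>"
    using assms by (meson Cinfinite_gt_empty)
  then show "refl_on (Pow X) (mod_small \<kappa> X)"
    by (auto simp: refl_on_def mod_small_iff)
  show "sym (mod_small \<kappa> X)"
    by (auto simp: sym_def mod_small_iff Un_commute)
  show "trans (mod_small \<kappa> X)"
  proof (rule transI)
    fix C D E assume "(C, D) \<in> mod_small \<kappa> X" "(D, E) \<in> mod_small \<kappa> X"
    moreover have "sym_diff C E \<subseteq> sym_diff C D \<union> sym_diff D E" by blast
    ultimately show "(C, E) \<in> mod_small \<kappa> X"
      using small_subset[OF small_Un[OF assms, of "sym_diff C D" "sym_diff D E"], of "sym_diff C E"]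
      by (simp add: mod_small_iff)
  qed
qed

lemma cls_eq_iff:
  assumes "Cinfinite \<kappa>" "C \<subseteq> X" "D \<subseteq> X"
  shows "cls \<kappa> X C = cls \<kappa> X D \<longleftrightarrow> |sym_diff C D| <o \<kappa>"
  using eq_equiv_class_iff[OF equiv_mod_small[OF assms(1)], of C X D] assms
  by (auto simp: cls_def mod_small_iff)

lemma cls_ops:
  assumes k: "Cinfinite \<kappa>" and C: "C \<subseteq> X" and D: "D \<subseteq> X"
  shows "bmeet (pow_mod \<kappa> X) (cls \<kappa> X C) (cls \<kappa> X D) = cls \<kappa> X (C \<inter> D)"
    and "bjoin (pow_mod \<kappa> X) (cls \<kappa> X C) (cls \<kappa> X D) = cls \<kappa> X (C \<union> D)"
    and "bcompl (pow_mod \<kappa> X) (cls \<kappa> X C) = cls \<kappa> X (X - C)"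
proof -
  have self: "E \<in> cls \<kappa> X E" if "E \<subseteq> X" for E
    using equiv_class_self[OF equiv_mod_small[OF k], of E X] that by (simp add: cls_def)
  have mem: "C' \<subseteq> X \<and> |sym_diff E C'| <o \<kappa>" if "C' \<in> cls \<kappa> X E" for C' E
    using that by (auto simp: cls_def mod_small_iff)
  have "cls \<kappa> X (C' \<inter> D') = cls \<kappa> X (C \<inter> D) \<and> cls \<kappa> X (C' \<union> D') = cls \<kappa> X (C \<union> D)"
    if "C' \<in> cls \<kappa> X C" "D' \<in> cls \<kappa> X D" for C' D'
  proof -
    have s: "|sym_diff C C' \<union> sym_diff D D'| <o \<kappa>" and sub: "C' \<subseteq> X" "D' \<subseteq> X"
      using mem[OF that(1)] mem[OF that(2)] small_Un[OF k] by auto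
    have "sym_diff (C' \<inter> D') (C \<inter> D) \<subseteq> sym_diff C C' \<union> sym_diff D D'"
         "sym_diff (C' \<union> D') (C \<union> D) \<subseteq> sym_diff C C' \<union> sym_diff D D'"
      by blast+
    then have "|sym_diff (C' \<inter> D') (C \<inter> D)| <o \<kappa>" "|sym_diff (C' \<union> D') (C \<union> D)| <o \<kappa>"
      using small_subset[OF s] by blast+
    moreover have "C' \<inter> D' \<subseteq> X" "C \<inter> D \<subseteq> X" "C' \<union> D' \<subseteq> X" "C \<union> D \<subseteq> X"
      using C D sub by auto
    ultimately show ?thesis
      using cls_eq_iff[OF k] by metis
  qed
  note rep = this
  have ne: "cls \<kappa> X C \<noteq> {}" "cls \<kappa> X D \<noteq> {}"
    using self[OF C] self[OF D] by blast+
  show "bmeet (pow_mod \<kappa> X) (cls \<kappa> X C) (cls \<kappa> X D) = cls \<kappa> X (C \<inter> D)"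
    and "bjoin (pow_mod \<kappa> X) (cls \<kappa> X C) (cls \<kappa> X D) = cls \<kappa> X (C \<union> D)"
    using ne by (simp_all add: pow_mod_def rep cong: SUP_cong_simp)
  have "cls \<kappa> X (X - C') = cls \<kappa> X (X - C)" if "C' \<in> cls \<kappa> X C" for C'
  proof -
    have "sym_diff (X - C') (X - C) \<subseteq> sym_diff C C'" by blast
    then have "|sym_diff (X - C') (X - C)| <o \<kappa>"
      using mem[OF that] small_subset by blast
    then show ?thesis
      using cls_eq_iff[OF k, of "X - C'" X "X - C"] by blast
  qed
  then show "bcompl (pow_mod \<kappa> X) (cls \<kappa> X C) = cls \<kappa> X (X - C)"
    using ne by (simp add: pow_mod_def cong: SUP_cong_simp)
qed


definition nice_representatives ::
    "'k rel \<Rightarrow> 'a set \<Rightarrow> 'a set set set \<Rightarrow> (bool list \<Rightarrow> 'a set) \<Rightarrow> bool" where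
  "nice_representatives \<kappa> L \<A> A \<longleftrightarrow>
     (\<forall>\<sigma>. A \<sigma> \<subseteq> L) \<and>
     (\<forall>\<sigma>. A (\<sigma> @ [False]) \<union> A (\<sigma> @ [True]) = A \<sigma> \<and> A (\<sigma> @ [False]) \<inter> A (\<sigma> @ [True]) = {}) \<and>
     bgenerates (pow_mod \<kappa> L) (range (\<lambda>\<sigma>. cls \<kappa> L (A \<sigma>))) \<A>"

definition countable_atomless_subalgebra :: "'b balg \<Rightarrow> 'b set \<Rightarrow> bool" where
  "countable_atomless_subalgebra P \<A> \<longleftrightarrow> bsubalgebra P \<A> \<and> countable \<A> \<and> batomless P \<A>"

definition initial_segment :: "bool list \<Rightarrow> (nat \<Rightarrow> bool) \<Rightarrow> bool" where
  "initial_segment \<sigma> x \<longleftrightarrow> (\<forall>i < length \<sigma>. \<sigma> ! i = x i)"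

definition branch_set :: "(bool list \<Rightarrow> 'a set) \<Rightarrow> (nat \<Rightarrow> bool) \<Rightarrow> 'a set" where
  "branch_set A x = \<Inter> {A \<sigma> |\<sigma>. initial_segment \<sigma> x}"

definition nonempty_branches :: "(bool list \<Rightarrow> 'a set) \<Rightarrow> (nat \<Rightarrow> bool) set" where
  "nonempty_branches A = {x. branch_set A x \<noteq> {}}"

definition trivial_map ::
    "'k rel \<Rightarrow> 'a set \<Rightarrow> 'b set \<Rightarrow> ('a set set \<Rightarrow> 'b set set) \<Rightarrow> bool" where
  "trivial_map \<kappa> X Y \<pi> \<longleftrightarrow>
     (\<exists>Y' f. Y' \<subseteq> Y \<and> |Y - Y'| <o \<kappa> \<and> f ` Y' \<subseteq> X \<and>
        (\<forall>C. C \<subseteq> X \<longrightarrow> \<pi> (cls \<kappa> X C) = cls \<kappa> Y {y \<in> Y'. f y \<in> C}))"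

end

theory Submission
  imports Defs
begin

text \<open>
  A trivial isomorphism is induced by a map which, off a small set, is injective with co-small
  range: a set meeting each non-trivial fibre in exactly one point can agree with a union of fibres
  modulo a small set only if there are few such fibres. As \<open>cf \<kappa> > \<omega>\<close>, the countably many errors
  on the levels of the trees together are small, so the map respects all \<open>B\<^sub>\<sigma>\<close>, hence all branches,
  off a small set; closing that set under the map and its inverse gives \<open>S\<close>. Conversely, bijections
  between the \<open>B\<^sub>x - S\<close> and the \<open>A\<^sub>x - S\<close> glue together to a map inducing the isomorphism.
\<close>

section \<open>Small sets\<close>

lemma unbounded_in_Field:
  assumes "Card_order \<kappa>"
  shows "unbounded_in (Field \<kappa>) \<kappa>"
proof -
  have "Refl \<kappa>"
    using assms unfolding card_order_on_def well_order_on_def linear_order_on_def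
      partial_order_on_def preorder_on_def by blast
  then show ?thesis
    by (auto simp: unbounded_in_def refl_on_def)
qed

text \<open>The choice in \<open>cf\<close> picks a genuine minimum because every nonempty family of
  well-orders has a \<open>\<le>o\<close>-least member.\<close>

lemma cf_le_unbounded:
  assumes \<kappa>: "Card_order \<kappa>" and B: "unbounded_in B \<kappa>"
  shows "cf \<kappa> \<le>o |B|"
proof -
  let ?R = "{|A| |A. unbounded_in A \<kappa>}"
  have "\<exists>r\<in>?R. \<forall>r'\<in>?R. r \<le>o r'"
    by (rule exists_minim_Well_order) (use B card_of_Well_order in blast)+
  then have "\<exists>A. unbounded_in A \<kappa> \<and> (\<forall>B. unbounded_in B \<kappa> \<longrightarrow> |A| \<le>o |B| )"
    by blast
  then show ?thesis
    unfolding cf_def by (rule someI2_ex) (use B in blast)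
qed

text \<open>The whole field is unbounded, so \<open>cf \<kappa>\<close> is at most \<kappa> and
  uncountability passes from the cofinality to \<kappa> itself.\<close>

lemma natLeq_less_if_natLeq_less_cf:
  assumes "Card_order \<kappa>" "natLeq <o cf \<kappa>"
  shows "natLeq <o \<kappa>"
  using cf_le_unbounded[OF assms(1) unbounded_in_Field] assms card_of_Field_ordIso
    ordLess_ordLeq_trans ordLess_ordIso_trans by blast

lemma Cinfinite_if_natLeq_less:
  assumes "Card_order \<kappa>" "natLeq <o \<kappa>"
  shows "Cinfinite \<kappa>"
  using assms cinfinite_mono[OF ordLess_imp_ordLeq] natLeq_Cinfinite
  by blast

text \<open>Each \<open>F n\<close> fits into a proper initial segment of \<kappa>. Countably many
  end points cannot be unbounded, so a single segment, still of size less than \<kappa>,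
  accommodates all \<open>F n\<close> at once.\<close>

lemma small_UN_nat:
  fixes F :: "nat \<Rightarrow> 'a set"
  assumes \<kappa>: "Card_order \<kappa>" and cf: "natLeq <o cf \<kappa>" and F: "\<And>n. |F n| <o \<kappa>"
  shows "|\<Union>n. F n| <o \<kappa>"
proof -
  have nat: "natLeq <o \<kappa>" and inf: "Cinfinite \<kappa>"
    using natLeq_less_if_natLeq_less_cf[OF \<kappa> cf] Cinfinite_if_natLeq_less[OF \<kappa>] by auto
  have wo: "wo_rel \<kappa>"
    using \<kappa> by (simp add: card_order_on_def wo_rel_def)
  have "\<exists>a\<in>Field \<kappa>. |F n| \<le>o |underS \<kappa> a|" for n
  proof -
    \<comment> \<open>A well-order below \<kappa> is isomorphic to a proper initial segment of
      \<kappa>; comparing fields then turns this into a bound on cardinalities.\<close>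
    obtain a where a: "a \<in> Field \<kappa>" "|F n| =o Restr \<kappa> (underS \<kappa> a)"
      using F[of n] ordLess_iff_ordIso_Restr[of \<kappa> "|F n|"] \<kappa> card_of_Well_order
      by (auto simp: card_order_on_def)
    have "|F n| =o |Field (Restr \<kappa> (underS \<kappa> a))|"
      using a(2) card_of_Field_ordIso[of "|F n|"] card_of_cong[OF a(2)] card_of_Card_order
        ordIso_symmetric ordIso_transitive by blast
    moreover have "Field (Restr \<kappa> (underS \<kappa> a)) \<subseteq> underS \<kappa> a"
      by (auto simp: Field_def)
    ultimately show ?thesis
      using a(1) card_of_mono1 ordIso_ordLeq_trans by blast
  qed
  then obtain a where a: "\<And>n. a n \<in> Field \<kappa>" "\<And>n. |F n| \<le>o |underS \<kappa> (a n)|"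
    by metis
  have "\<not> unbounded_in (range a) \<kappa>"
  proof
    assume "unbounded_in (range a) \<kappa>"
    then have "cf \<kappa> \<le>o |range a|"
      by (rule cf_le_unbounded[OF \<kappa>])
    moreover have "|range a| \<le>o natLeq"
      using card_of_image[of a UNIV] card_of_nat ordLeq_ordIso_trans by blast
    ultimately show False
      using cf ordLeq_transitive not_ordLess_ordLeq by blast
  qed
  \<comment> \<open>The witness against unboundedness lies below no \<open>a n\<close>, so by
    totality it lies above all of them.\<close>
  then obtain b where b: "b \<in> Field \<kappa>" "\<And>n. (b, a n) \<notin> \<kappa>"
    using a(1) by (auto simp: unbounded_in_def)
  have "|F n| \<le>o |underS \<kappa> b|" for n
  proof -
    have "(a n, b) \<in> \<kappa>"
      using wo_rel.TOTALS[OF wo] b a(1)[of n] by blast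
    then have "underS \<kappa> (a n) \<subseteq> underS \<kappa> b"
      using underS_incr[of \<kappa> "a n" b] wo_rel.TRANS[OF wo] wo_rel.ANTISYM[OF wo] by blast
    then show ?thesis
      using a(2)[of n] card_of_mono1 ordLeq_transitive by blast
  qed
  note bound = this
  \<comment> \<open>The summand of naturals makes the bound infinite even if the segment below
    \<open>b\<close> is finite, and also bounds the number of sets in the union.\<close>
  let ?M = "(UNIV :: nat set) <+> underS \<kappa> b"
  have M: "|?M| <o \<kappa>"
  proof (rule card_of_Plus_ordLess_infinite_Field)
    show "infinite (Field \<kappa>)" "Card_order \<kappa>"
      using inf by (auto simp: cinfinite_def)
    show "|UNIV :: nat set| <o \<kappa>"
      using card_of_nat nat ordIso_ordLess_trans by blast
    show "|underS \<kappa> b| <o \<kappa>"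
      by (rule card_of_underS[OF \<kappa> b(1)])
  qed
  have "|\<Union>n. F n| \<le>o |?M|"
  proof (rule card_of_UNION_ordLeq_infinite)
    show "infinite ?M" by simp
    show "|UNIV :: nat set| \<le>o |?M|" by (rule card_of_Plus1)
    show "\<forall>n\<in>UNIV. |F n| \<le>o |?M|"
      using bound card_of_Plus2 ordLeq_transitive by blast
  qed
  then show ?thesis
    using M ordLeq_ordLess_trans by blast
qed

text \<open>Serves for families indexed by the nodes of a tree, that is, by finite bit
  strings.\<close>

lemma small_UN_countable:
  fixes F :: "'i::countable \<Rightarrow> 'a set"
  assumes "Card_order \<kappa>" "natLeq <o cf \<kappa>" "\<And>i. |F i| <o \<kappa>"
  shows "|\<Union>i. F i| <o \<kappa>"
proof (rule small_subset)
  show "|\<Union>n. F (from_nat n)| <o \<kappa>"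
    using assms by (rule small_UN_nat)
  show "(\<Union>i. F i) \<subseteq> (\<Union>n. F (from_nat n))"
  proof (rule UN_least)
    show "F i \<subseteq> (\<Union>n. F (from_nat n))" for i
      using UN_upper[of "to_nat i" UNIV "\<lambda>n. F (from_nat n)"] by simp
  qed
qed

lemma small_image: "|C| <o \<kappa> \<Longrightarrow> |f ` C| <o \<kappa>"
  using card_of_image ordLeq_ordLess_trans by blast

lemma small_vimage_inj_on:
  assumes "inj_on f Z" "|C| <o \<kappa>"
  shows "|{z \<in> Z. f z \<in> C}| <o \<kappa>"
proof -
  have "|{z \<in> Z. f z \<in> C}| \<le>o |C|"
    by (rule card_of_ordLeqI[of f]) (use assms(1) in \<open>auto simp: inj_on_def\<close>)
  then show ?thesis
    using assms(2) ordLeq_ordLess_trans by blast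
qed

text \<open>Closing \<open>S\<close> under \<open>f\<close> and its inverse takes countably many
  stages. Injectivity keeps preimages small, so each stage is small, and so is their union. Off the
  closure, \<open>f\<close> restricts to a bijection between what remains of \<open>Z\<close> and of
  its image.\<close>

lemma small_superset_closed_under_injection:
  assumes "Card_order \<kappa>" "natLeq <o cf \<kappa>"
    and inj: "inj_on f Z" and S: "|S| <o \<kappa>" "S \<subseteq> L" "Z \<subseteq> L" "f ` Z \<subseteq> L"
  obtains T where "S \<subseteq> T" "T \<subseteq> L" "|T| <o \<kappa>" "\<And>z. z \<in> Z \<Longrightarrow> f z \<in> T \<longleftrightarrow> z \<in> T"
proof -
  have inf: "Cinfinite \<kappa>"
    using Cinfinite_if_natLeq_less natLeq_less_if_natLeq_less_cf assms(1,2) by blast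
  define step where "step C = C \<union> (f ` (C \<inter> Z) \<union> {z \<in> Z. f z \<in> C})" for C
  define F where "F n = (step ^^ n) S" for n
  have F_Suc: "F (Suc n) = step (F n)" and F_0: "F 0 = S" for n
    by (simp_all add: F_def)
  have "|F n| <o \<kappa> \<and> F n \<subseteq> L" for n
  proof (induction n)
    case 0
    then show ?case using S by (simp add: F_0)
  next
    case (Suc n)
    have "|f ` (F n \<inter> Z)| <o \<kappa>"
      using Suc by (intro small_image) (auto intro: small_subset)
    then have "|step (F n)| <o \<kappa>"
      using Suc small_vimage_inj_on[OF inj] unfolding step_def by (blast intro: small_Un[OF inf])
    then show ?case
      using Suc S by (auto simp: F_Suc step_def)
  qed
  note F = this
  show thesis
  proof
    show "S \<subseteq> (\<Union>n. F n)" using F_0 by blast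
    show "(\<Union>n. F n) \<subseteq> L" using F by blast
    show "|\<Union>n. F n| <o \<kappa>" using F by (intro small_UN_nat[OF assms(1,2)]) blast
    fix z assume "z \<in> Z"
    \<comment> \<open>One stage is enough to travel along \<open>f\<close> once in either
      direction.\<close>
    then have "z \<in> F n \<Longrightarrow> f z \<in> F (Suc n)" "f z \<in> F n \<Longrightarrow> z \<in> F (Suc n)" for n
      by (auto simp: F_Suc step_def)
    then show "f z \<in> (\<Union>n. F n) \<longleftrightarrow> z \<in> (\<Union>n. F n)" by blast
  qed
qed


section \<open>Trivial isomorphisms\<close>

lemma bcarrier_pow_mod: "bcarrier (pow_mod \<kappa> X) = cls \<kappa> X ` Pow X"
  by (auto simp: pow_mod_def quotient_def cls_def)

lemma bzero_pow_mod: "bzero (pow_mod \<kappa> X) = cls \<kappa> X {}"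
  and bone_pow_mod: "bone (pow_mod \<kappa> X) = cls \<kappa> X X"
  by (simp_all add: pow_mod_def)

text \<open>Surjectivity of \<pi>, applied to a transversal of the fibres with several points, shows
  that there are few such fibres. Injectivity of \<pi> then bounds the points in these fibres and
  the points missed by \<open>f\<close>.\<close>

lemma biso_induced_almost_bijective:
  assumes \<kappa>: "Cinfinite \<kappa>" and iso: "biso (pow_mod \<kappa> X) (pow_mod \<kappa> Y) \<pi>"
    and Y': "Y' \<subseteq> Y" "|Y - Y'| <o \<kappa>" and f: "f ` Y' \<subseteq> X"
    and \<pi>: "\<And>C. C \<subseteq> X \<Longrightarrow> \<pi> (cls \<kappa> X C) = cls \<kappa> Y {y \<in> Y'. f y \<in> C}"
  obtains Z where "Z \<subseteq> Y'" "|Y - Z| <o \<kappa>" "inj_on f Z" "|X - f ` Z| <o \<kappa>"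
proof -
  have bij: "bij_betw \<pi> (cls \<kappa> X ` Pow X) (cls \<kappa> Y ` Pow Y)"
    using iso by (simp add: biso_def bcarrier_pow_mod)
  \<comment> \<open>Being small means having the class of the empty set, a property that the
    injective \<pi> preserves and reflects.\<close>
  have small_iff: "|{y \<in> Y'. f y \<in> C}| <o \<kappa> \<longleftrightarrow> |C| <o \<kappa>" if "C \<subseteq> X" for C
  proof -
    have "|C| <o \<kappa> \<longleftrightarrow> cls \<kappa> X C = cls \<kappa> X {}"
      using cls_eq_iff[OF \<kappa> that, of "{}"] by simp
    also have "\<dots> \<longleftrightarrow> \<pi> (cls \<kappa> X C) = \<pi> (cls \<kappa> X {})"
      using bij that by (intro inj_on_eq_iff[symmetric]) (auto simp: bij_betw_def)
    also have "\<dots> \<longleftrightarrow> |{y \<in> Y'. f y \<in> C}| <o \<kappa>"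
      using \<pi>[OF that] \<pi>[of "{}"] cls_eq_iff[OF \<kappa>, of "{y \<in> Y'. f y \<in> C}" Y "{}"] Y' by auto
    finally show ?thesis by blast
  qed
  define N where "N = {y \<in> Y'. \<exists>y'\<in>Y'. y' \<noteq> y \<and> f y' = f y}"
  define r where "r p = (SOME y. y \<in> Y' \<and> f y = p)" for p
  have r: "r p \<in> Y' \<and> f (r p) = p" if "p \<in> f ` Y'" for p
    unfolding r_def by (rule someI_ex) (use that in blast)
  \<comment> \<open>One point from each fibre with at least two points.\<close>
  define D where "D = {y \<in> N. y = r (f y)}"
  have "cls \<kappa> Y D \<in> \<pi> ` cls \<kappa> X ` Pow X"
    using bij Y' by (auto simp: bij_betw_def D_def N_def)
  then obtain C where C: "C \<subseteq> X" "cls \<kappa> Y D = cls \<kappa> Y {y \<in> Y'. f y \<in> C}"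
    using \<pi> by auto
  have small: "|sym_diff D {y \<in> Y'. f y \<in> C}| <o \<kappa>"
    using C(2) by (subst (asm) cls_eq_iff[OF \<kappa>]) (use Y' in \<open>auto simp: D_def N_def\<close>)
  \<comment> \<open>A fibre inside \<open>f -` C\<close> has a point outside the transversal \<open>D\<close>; a fibre outside
    \<open>f -` C\<close> has its point of \<open>D\<close>.\<close>
  have "f ` N \<subseteq> f ` sym_diff D {y \<in> Y'. f y \<in> C}"
  proof
    fix p assume "p \<in> f ` N"
    then obtain y y' where y: "y \<in> Y'" "y' \<in> Y'" "y' \<noteq> y" "f y' = p" "f y = p"
      by (auto simp: N_def)
    have rp: "r p \<in> Y'" "f (r p) = p" using r[of p] y by auto
    \<comment> \<open>Two distinct points of the fibre cannot both be the chosen one.\<close>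
    obtain z where z: "z \<in> Y'" "f z = p" "z \<noteq> r p" using y by metis
    show "p \<in> f ` sym_diff D {y \<in> Y'. f y \<in> C}"
    proof (cases "p \<in> C")
      case True
      then have "z \<in> sym_diff D {y \<in> Y'. f y \<in> C}" using z by (auto simp: D_def)
      then show ?thesis using z by blast
    next
      case False
      have "r p \<in> N" using rp z by (auto simp: N_def)
      then have "r p \<in> sym_diff D {y \<in> Y'. f y \<in> C}" using rp False by (auto simp: D_def)
      then have "f (r p) \<in> f ` sym_diff D {y \<in> Y'. f y \<in> C}" by (rule imageI)
      then show ?thesis unfolding rp(2) .
    qed
  qed
  then have fN: "|f ` N| <o \<kappa>"
    using small_image[OF small] small_subset by blast
  \<comment> \<open>Few fibres need not mean few points; but \<open>N\<close> lies in the preimage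
    of a small set, which is small by \<open>small_iff\<close>.\<close>
  have "N \<subseteq> {y \<in> Y'. f y \<in> f ` N}" by (auto simp: N_def)
  moreover have "f ` N \<subseteq> X" using f by (auto simp: N_def)
  ultimately have N: "|N| <o \<kappa>"
    using fN small_iff[of "f ` N"] small_subset by blast
  \<comment> \<open>The points missed by \<open>f\<close> have an empty, hence small,
    preimage.\<close>
  have empty: "{y \<in> Y'. f y \<in> X - f ` Y'} = {}" by blast
  have "|{y \<in> Y'. f y \<in> X - f ` Y'}| <o \<kappa>"
    unfolding empty by (rule Cinfinite_gt_empty[OF \<kappa>])
  then have range: "|X - f ` Y'| <o \<kappa>"
    unfolding small_iff[OF Diff_subset] .
  show thesis
  proof
    show "Y' - N \<subseteq> Y'" by blast
    show "inj_on f (Y' - N)" by (auto simp: inj_on_def N_def)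
    have "Y - (Y' - N) \<subseteq> (Y - Y') \<union> N" by blast
    then show "|Y - (Y' - N)| <o \<kappa>"
      using small_Un[OF \<kappa> Y'(2) N] small_subset by blast
    have "X - f ` (Y' - N) \<subseteq> (X - f ` Y') \<union> f ` N" by blast
    then show "|X - f ` (Y' - N)| <o \<kappa>"
      using small_Un[OF \<kappa> range fN] small_subset by blast
  qed
qed

text \<open>Taking preimages under \<open>f\<close> respects smallness in both directions, so it
  induces an injection of classes. All failures to be a Boolean isomorphism on the level of sets lie
  in the small set \<open>Y - Y'\<close>.\<close>

lemma trivial_biso_of_almost_bijection:
  assumes \<kappa>: "Cinfinite \<kappa>" and f: "bij_betw f Y' X'"
    and Y': "Y' \<subseteq> Y" "|Y - Y'| <o \<kappa>" and X': "X' \<subseteq> X" "|X - X'| <o \<kappa>"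
  obtains \<pi> where "biso (pow_mod \<kappa> X) (pow_mod \<kappa> Y) \<pi>" "trivial_map \<kappa> X Y \<pi>"
    "\<And>C. C \<subseteq> X \<Longrightarrow> \<pi> (cls \<kappa> X C) = cls \<kappa> Y {y \<in> Y'. f y \<in> C}"
proof -
  let ?p = "\<lambda>C. {y \<in> Y'. f y \<in> C}"
  have inj: "inj_on f Y'" and im: "f ` Y' = X'"
    using f by (auto simp: bij_betw_def)
  have pY: "?p C \<subseteq> Y" for C using Y' by blast
  have p_eq: "cls \<kappa> Y (?p C) = cls \<kappa> Y (?p D) \<longleftrightarrow> cls \<kappa> X C = cls \<kappa> X D"
    if CD: "C \<subseteq> X" "D \<subseteq> X" for C D
  proof -
    have p: "sym_diff (?p C) (?p D) = ?p (sym_diff C D)" by blast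
    have "|?p (sym_diff C D)| <o \<kappa> \<longleftrightarrow> |sym_diff C D| <o \<kappa>"
    proof
      assume "|?p (sym_diff C D)| <o \<kappa>"
      then have "|f ` ?p (sym_diff C D) \<union> (X - X')| <o \<kappa>"
        using X' by (intro small_Un[OF \<kappa>] small_image)
      \<comment> \<open>The part inside \<open>X'\<close> is recovered as the image of its preimage;
        the rest lies in the small set \<open>X - X'\<close>.\<close>
      moreover have "sym_diff C D \<subseteq> f ` ?p (sym_diff C D) \<union> (X - X')"
        using CD im by blast
      ultimately show "|sym_diff C D| <o \<kappa>" by (rule small_subset)
    qed (rule small_vimage_inj_on[OF inj])
    then show ?thesis
      by (simp add: cls_eq_iff[OF \<kappa> CD] cls_eq_iff[OF \<kappa> pY pY] p)
  qed
  \<comment> \<open>The choice of representative is harmless by \<open>p_eq\<close>.\<close>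
  define \<pi> where "\<pi> a = cls \<kappa> Y (?p (SOME C. C \<subseteq> X \<and> a = cls \<kappa> X C))" for a
  have \<pi>: "\<pi> (cls \<kappa> X C) = cls \<kappa> Y (?p C)" if "C \<subseteq> X" for C
  proof -
    have "(SOME D. D \<subseteq> X \<and> cls \<kappa> X C = cls \<kappa> X D) \<subseteq> X \<and>
        cls \<kappa> X C = cls \<kappa> X (SOME D. D \<subseteq> X \<and> cls \<kappa> X C = cls \<kappa> X D)"
      by (rule someI_ex) (use that in blast)
    then show ?thesis
      unfolding \<pi>_def using p_eq that by blast
  qed
  have almost: "cls \<kappa> Y C = cls \<kappa> Y D" if "C \<subseteq> Y" "D \<subseteq> Y" "sym_diff C D \<subseteq> Y - Y'" for C D
    using cls_eq_iff[OF \<kappa>] small_subset[OF Y'(2)] that by metis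
  have surj: "cls \<kappa> Y D \<in> \<pi> ` cls \<kappa> X ` Pow X" if "D \<subseteq> Y" for D
  proof -
    \<comment> \<open>By injectivity, the preimage of this image is \<open>D\<close> without its
      points outside \<open>Y'\<close>.\<close>
    have sub: "f ` (D \<inter> Y') \<subseteq> X" using im X' by blast
    then have "\<pi> (cls \<kappa> X (f ` (D \<inter> Y'))) = cls \<kappa> Y (?p (f ` (D \<inter> Y')))"
      by (rule \<pi>)
    also have "\<dots> = cls \<kappa> Y D"
      using inj that by (intro almost pY) (auto simp: inj_on_def)
    finally show ?thesis using sub by (metis PowI image_eqI)
  qed
  have "biso (pow_mod \<kappa> X) (pow_mod \<kappa> Y) \<pi>"
    unfolding biso_def bcarrier_pow_mod bzero_pow_mod bone_pow_mod
  proof (intro conjI ballI)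
    show "bij_betw \<pi> (cls \<kappa> X ` Pow X) (cls \<kappa> Y ` Pow Y)"
      unfolding bij_betw_def
    proof
      show "inj_on \<pi> (cls \<kappa> X ` Pow X)"
        by (rule inj_onI) (auto simp: \<pi> p_eq)
      show "\<pi> ` cls \<kappa> X ` Pow X = cls \<kappa> Y ` Pow Y"
        using surj pY by (auto simp: \<pi>)
    qed
    show "\<pi> (cls \<kappa> X {}) = cls \<kappa> Y {}" by (simp add: \<pi>)
    have "\<pi> (cls \<kappa> X X) = cls \<kappa> Y (?p X)" by (simp add: \<pi>)
    also have "\<dots> = cls \<kappa> Y Y"
      using im X' Y' by (intro almost) auto
    finally show "\<pi> (cls \<kappa> X X) = cls \<kappa> Y Y" .
  next
    fix a assume "a \<in> cls \<kappa> X ` Pow X"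
    then obtain C where C: "C \<subseteq> X" "a = cls \<kappa> X C" by blast
    have "\<pi> (cls \<kappa> X (X - C)) = cls \<kappa> Y (?p (X - C))" by (simp add: \<pi>)
    also have "\<dots> = cls \<kappa> Y (Y - ?p C)"
      using im X' Y' by (intro almost) auto
    finally show "\<pi> (bcompl (pow_mod \<kappa> X) a) = bcompl (pow_mod \<kappa> Y) (\<pi> a)"
      unfolding C(2) \<pi>[OF C(1)] cls_ops(3)[OF \<kappa> C(1) C(1)] cls_ops(3)[OF \<kappa> pY pY] .
  next
    fix a b assume "a \<in> cls \<kappa> X ` Pow X" "b \<in> cls \<kappa> X ` Pow X"
    then obtain C D where C: "C \<subseteq> X" "a = cls \<kappa> X C" and D: "D \<subseteq> X" "b = cls \<kappa> X D" by blast
    have CD: "C \<inter> D \<subseteq> X" "C \<union> D \<subseteq> X" using C D by auto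
    \<comment> \<open>Unlike complements, intersections and unions are preserved exactly, with no
      small error.\<close>
    have p: "?p (C \<inter> D) = ?p C \<inter> ?p D" "?p (C \<union> D) = ?p C \<union> ?p D" by auto
    show "\<pi> (bmeet (pow_mod \<kappa> X) a b) = bmeet (pow_mod \<kappa> Y) (\<pi> a) (\<pi> b)"
      "\<pi> (bjoin (pow_mod \<kappa> X) a b) = bjoin (pow_mod \<kappa> Y) (\<pi> a) (\<pi> b)"
      unfolding C(2) D(2) \<pi>[OF C(1)] \<pi>[OF D(1)] cls_ops[OF \<kappa> C(1) D(1)] cls_ops[OF \<kappa> pY pY]
        \<pi>[OF CD(1)] \<pi>[OF CD(2)] p by (rule refl)+
  qed
  moreover have "trivial_map \<kappa> X Y \<pi>"
    unfolding trivial_map_def using Y' X' im \<pi> by blast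
  ultimately show thesis
    using that \<pi> by blast
qed


section \<open>Branches of partition trees\<close>

text \<open>Isolates the splitting clause of \<open>nice_representatives\<close>, so that branches
  can be studied apart from the quotient algebra.\<close>

definition partition_tree :: "(bool list \<Rightarrow> 'a set) \<Rightarrow> bool" where
  "partition_tree A \<longleftrightarrow>
     (\<forall>\<sigma>. A (\<sigma> @ [False]) \<union> A (\<sigma> @ [True]) = A \<sigma> \<and> A (\<sigma> @ [False]) \<inter> A (\<sigma> @ [True]) = {})"

text \<open>Treats both children uniformly: inside a node, membership in the \<open>True\<close>
  child decides the next bit.\<close>

lemma partition_tree_step:
  assumes "partition_tree A"
  shows "y \<in> A (\<sigma> @ [b]) \<longleftrightarrow> y \<in> A \<sigma> \<and> (y \<in> A (\<sigma> @ [True]) \<longleftrightarrow> b)"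
proof -
  have "A (\<sigma> @ [False]) \<union> A (\<sigma> @ [True]) = A \<sigma>" "A (\<sigma> @ [False]) \<inter> A (\<sigma> @ [True]) = {}"
    using assms by (auto simp: partition_tree_def)
  then show ?thesis by (cases b) auto
qed

lemma partition_tree_subset_root:
  assumes "partition_tree A"
  shows "A \<sigma> \<subseteq> A []"
proof (induction \<sigma> rule: rev_induct)
  case (snoc b \<sigma>)
  have "A (\<sigma> @ [b]) \<subseteq> A \<sigma>"
    using partition_tree_step[OF assms, of _ \<sigma> b] by blast
  then show ?case using snoc by blast
qed simp

text \<open>A common point lies in both parents, which agree by induction; the last bits agree since
  both record membership in the same \<open>True\<close> child.\<close>

lemma partition_tree_same_level:
  assumes "partition_tree A" "length \<sigma> = length \<tau>" "y \<in> A \<sigma>" "y \<in> A \<tau>"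
  shows "\<sigma> = \<tau>"
  using assms(2-4)
proof (induction \<sigma> arbitrary: \<tau> rule: rev_induct)
  case (snoc b \<sigma>)
  obtain \<rho> c where \<tau>: "\<tau> = \<rho> @ [c]"
    using snoc.prems(1) by (cases \<tau> rule: rev_exhaust) auto
  have b: "y \<in> A \<sigma>" "y \<in> A (\<sigma> @ [True]) \<longleftrightarrow> b"
    using partition_tree_step[OF assms(1), of y \<sigma> b] snoc.prems(2) by blast+
  have c: "y \<in> A \<rho>" "y \<in> A (\<rho> @ [True]) \<longleftrightarrow> c"
    using partition_tree_step[OF assms(1), of y \<rho> c] snoc.prems(3) \<tau> by blast+
  have "\<sigma> = \<rho>"
    using snoc.IH[of \<rho>] snoc.prems(1) \<tau> b(1) c(1) by simp
  then show ?case
    using \<tau> b(2) c(2) by simp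
qed auto

lemma initial_segment_iff: "initial_segment \<sigma> x \<longleftrightarrow> \<sigma> = map x [0..<length \<sigma>]"
  unfolding initial_segment_def list_eq_iff_nth_eq by simp

lemma mem_branch_set_iff: "y \<in> branch_set A x \<longleftrightarrow> (\<forall>n. y \<in> A (map x [0..<n]))"
proof
  assume y: "y \<in> branch_set A x"
  have "initial_segment (map x [0..<n]) x" for n by (simp add: initial_segment_def)
  then show "\<forall>n. y \<in> A (map x [0..<n])" using y by (auto simp: branch_set_def)
next
  assume "\<forall>n. y \<in> A (map x [0..<n])"
  then have "y \<in> A \<sigma>" if "initial_segment \<sigma> x" for \<sigma>
    using that unfolding initial_segment_iff by metis
  then show "y \<in> branch_set A x" by (auto simp: branch_set_def)
qed

text \<open>Nodes of one level are disjoint, so the branch through a point determines all nodes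
  containing it. Hence a map that respects branches respects every node.\<close>

lemma branch_set_mem_iff:
  assumes "partition_tree A" "y \<in> branch_set A x"
  shows "y \<in> A \<sigma> \<longleftrightarrow> initial_segment \<sigma> x"
proof -
  have "y \<in> A (map x [0..<length \<sigma>])"
    using assms(2) by (simp add: mem_branch_set_iff)
  moreover have "length \<sigma> = length (map x [0..<length \<sigma>])"
    by simp
  ultimately show ?thesis
    unfolding initial_segment_iff using partition_tree_same_level[OF assms(1)] by metis
qed

lemma branch_set_unique:
  assumes "partition_tree A" "y \<in> branch_set A x" "y \<in> branch_set A x'"
  shows "x = x'"
proof
  fix n
  \<comment> \<open>Level \<open>Suc n\<close> is the first whose strings contain the entry at
    \<open>n\<close>.\<close>
  have "map x [0..<Suc n] = map x' [0..<Suc n]"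
    using assms by (intro partition_tree_same_level[OF assms(1), of _ _ y])
      (auto simp: mem_branch_set_iff simp del: upt_Suc)
  then show "x n = x' n" by simp
qed

lemma branch_set_exists:
  assumes "partition_tree A" "y \<in> A []"
  shows "\<exists>x. y \<in> branch_set A x"
proof -
  \<comment> \<open>The path that follows \<open>y\<close> down the tree, always stepping into the
    child that contains \<open>y\<close>.\<close>
  define pre where "pre = rec_nat [] (\<lambda>_ \<sigma>. \<sigma> @ [y \<in> A (\<sigma> @ [True])])"
  define x where "x n = (y \<in> A (pre n @ [True]))" for n
  have pre: "pre 0 = []" "pre (Suc n) = pre n @ [x n]" for n
    by (simp_all add: pre_def x_def)
  have "map x [0..<n] = pre n \<and> y \<in> A (pre n)" for n
  proof (induction n)
    case (Suc n)
    have "y \<in> A (pre n @ [x n])"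
      using partition_tree_step[OF assms(1), of y "pre n" "x n"] Suc x_def by blast
    then show ?case
      using Suc by (simp add: pre)
  qed (simp add: pre assms(2))
  then have "y \<in> branch_set A x"
    by (simp add: mem_branch_set_iff)
  then show ?thesis by blast
qed

lemma branch_set_subset_root: "branch_set A x \<subseteq> A []"
proof
  fix y assume "y \<in> branch_set A x"
  then have "y \<in> A (map x [0..<0])"
    unfolding mem_branch_set_iff by blast
  then show "y \<in> A []" by simp
qed

section \<open>Comparison of two partition trees\<close>

lemma small_branches_within:
  assumes "partition_tree A" "|S| <o \<kappa>" "\<And>x. x \<in> E \<Longrightarrow> branch_set A x \<noteq> {} \<and> branch_set A x \<subseteq> S"
  shows "|E| <o \<kappa>"
proof -
  \<comment> \<open>Branch sets are disjoint, so choosing a point from each one is an injection into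
    \<open>S\<close>.\<close>
  define p where "p x = (SOME y. y \<in> branch_set A x)" for x
  have p: "p x \<in> branch_set A x" if "x \<in> E" for x
    unfolding p_def using assms(3)[OF that] by (simp add: some_in_eq)
  have "|E| \<le>o |S|"
  proof (rule card_of_ordLeqI[of p])
    show "inj_on p E" using p branch_set_unique[OF assms(1)] by (intro inj_onI) metis
    show "\<And>x. x \<in> E \<Longrightarrow> p x \<in> S" using p assms(3) by blast
  qed
  then show ?thesis
    using assms(2) ordLeq_ordLess_trans by blast
qed

text \<open>If a branch is empty in one tree, its set in the other tree lies inside
  \<open>S\<close>, and only few nonempty branch sets fit there.\<close>

lemma small_sym_diff_nonempty_branches:
  assumes \<kappa>: "Cinfinite \<kappa>" and A: "partition_tree A" and B: "partition_tree B"
    and S: "|S| <o \<kappa>" and eq: "\<And>x. |branch_set A x - S| =o |branch_set B x - S|"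
  shows "|sym_diff (nonempty_branches A) (nonempty_branches B)| <o \<kappa>"
proof (rule small_Un[OF \<kappa>])
  have sub: "branch_set A x \<subseteq> S \<longleftrightarrow> branch_set B x \<subseteq> S" for x
  proof -
    obtain g where "bij_betw g (branch_set A x - S) (branch_set B x - S)"
      using eq[of x] card_of_ordIso by blast
    then show ?thesis by (auto simp: bij_betw_def)
  qed
  show "|nonempty_branches A - nonempty_branches B| <o \<kappa>"
    using A S by (rule small_branches_within) (use sub in \<open>auto simp: nonempty_branches_def\<close>)
  show "|nonempty_branches B - nonempty_branches A| <o \<kappa>"
    using B S by (rule small_branches_within) (use sub in \<open>auto simp: nonempty_branches_def\<close>)
qed

text \<open>The branch sets partition the root, so bijections chosen branch by branch combine into
  one. They run from \<open>B\<close> to \<open>A\<close> because a trivial map acts by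
  preimages.\<close>

lemma glue_branch_bijections:
  assumes A: "partition_tree A" and B: "partition_tree B"
    and eq: "\<And>x. |branch_set A x - S| =o |branch_set B x - S|"
  obtains f where "bij_betw f (B [] - S) (A [] - S)"
    "\<And>y \<sigma>. y \<in> B [] - S \<Longrightarrow> f y \<in> A \<sigma> \<longleftrightarrow> y \<in> B \<sigma>"
proof -
  have "\<forall>x. \<exists>g. bij_betw g (branch_set B x - S) (branch_set A x - S)"
    unfolding card_of_ordIso by (intro allI ordIso_symmetric[OF eq])
  from choice[OF this]
  obtain g where g: "\<And>x. bij_betw (g x) (branch_set B x - S) (branch_set A x - S)"
    by blast
  define br where "br y = (SOME x. y \<in> branch_set B x)" for y
  have br: "y \<in> branch_set B (br y)" if "y \<in> B []" for y
    unfolding br_def by (rule someI_ex[OF branch_set_exists[OF B that]])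
  define f where "f y = g (br y) y" for y
  have f: "f y \<in> branch_set A (br y) - S" if "y \<in> B [] - S" for y
    using g[of "br y"] br[of y] that by (auto simp: bij_betw_def f_def)
  show thesis
  proof
    show "f y \<in> A \<sigma> \<longleftrightarrow> y \<in> B \<sigma>" if "y \<in> B [] - S" for y \<sigma>
      using branch_set_mem_iff[OF A, of "f y" "br y"] branch_set_mem_iff[OF B, of y "br y"]
        f[OF that] br that by auto
    show "bij_betw f (B [] - S) (A [] - S)"
      unfolding bij_betw_def
    proof
      show "inj_on f (B [] - S)"
      proof (rule inj_onI)
        fix y z assume yz: "y \<in> B [] - S" "z \<in> B [] - S" "f y = f z"
        then have "br y = br z"
          using branch_set_unique[OF A, of "f y" "br y" "br z"] f[of y] f[of z] by simp
        then have "y \<in> branch_set B (br y) - S" "z \<in> branch_set B (br y) - S" "g (br y) y = g (br y) z"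
          using yz br[of y] br[of z] by (auto simp: f_def)
        then show "y = z"
          using g[of "br y"] by (auto simp: bij_betw_def inj_on_def)
      qed
      show "f ` (B [] - S) = A [] - S"
      proof
        show "f ` (B [] - S) \<subseteq> A [] - S"
        proof
          fix p assume "p \<in> f ` (B [] - S)"
          then obtain y where "y \<in> B [] - S" "p = f y" by blast
          then show "p \<in> A [] - S"
            using f[of y] branch_set_subset_root[of A "br y"] by blast
        qed
        show "A [] - S \<subseteq> f ` (B [] - S)"
        proof
          fix z assume z: "z \<in> A [] - S"
          then obtain x where "z \<in> branch_set A x"
            using branch_set_exists[OF A] by blast
          then obtain y where y: "y \<in> branch_set B x - S" "z = g x y"
            using g[of x] z by (auto simp: bij_betw_def)
          have "y \<in> B []" using y branch_set_subset_root[of B x] by blast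
          then have "br y = x" using br[of y] y branch_set_unique[OF B, of y "br y" x] by blast
          then show "z \<in> f ` (B [] - S)"
            using y \<open>y \<in> B []\<close> by (auto simp: f_def)
        qed
      qed
    qed
  qed
qed

lemma branches_equinumerous_off_small:
  assumes \<kappa>: "Card_order \<kappa>" "natLeq <o cf \<kappa>"
    and A: "partition_tree A" "A [] \<subseteq> L" and B: "partition_tree B" "B [] \<subseteq> L"
    and iso: "biso (pow_mod \<kappa> (A [])) (pow_mod \<kappa> (B [])) \<pi>"
    and trivial: "trivial_map \<kappa> (A []) (B []) \<pi>"
    and \<pi>: "\<And>\<sigma>. \<pi> (cls \<kappa> (A []) (A \<sigma>)) = cls \<kappa> (B []) (B \<sigma>)"
  obtains S where "S \<subseteq> L" "|S| <o \<kappa>" "\<And>x. |branch_set A x - S| =o |branch_set B x - S|"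
proof -
  have inf: "Cinfinite \<kappa>"
    using Cinfinite_if_natLeq_less natLeq_less_if_natLeq_less_cf \<kappa> by blast
  note AR = partition_tree_subset_root[OF A(1)] and BR = partition_tree_subset_root[OF B(1)]
  obtain Y' f where Y': "Y' \<subseteq> B []" "|B [] - Y'| <o \<kappa>" and f: "f ` Y' \<subseteq> A []"
    and \<pi>f: "\<And>C. C \<subseteq> A [] \<Longrightarrow> \<pi> (cls \<kappa> (A []) C) = cls \<kappa> (B []) {y \<in> Y'. f y \<in> C}"
    using trivial unfolding trivial_map_def by blast
  obtain Z where Z: "Z \<subseteq> Y'" "|B [] - Z| <o \<kappa>" "inj_on f Z" "|A [] - f ` Z| <o \<kappa>"
    using biso_induced_almost_bijective[OF inf iso Y' f \<pi>f] by blast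
  \<comment> \<open>The points where \<open>f\<close> disagrees with some node. Each node
    contributes a small error, and there are only countably many nodes.\<close>
  define E where "E = (\<Union>\<sigma>. sym_diff (B \<sigma>) {y \<in> Y'. f y \<in> A \<sigma>})"
  have "|sym_diff (B \<sigma>) {y \<in> Y'. f y \<in> A \<sigma>}| <o \<kappa>" for \<sigma>
  proof -
    have sub: "{y \<in> Y'. f y \<in> A \<sigma>} \<subseteq> B []" using Y' by blast
    have "cls \<kappa> (B []) (B \<sigma>) = cls \<kappa> (B []) {y \<in> Y'. f y \<in> A \<sigma>}"
      using \<pi>[of \<sigma>] \<pi>f[OF AR, of \<sigma>] by (rule trans[OF sym])
    then show ?thesis
      unfolding cls_eq_iff[OF inf BR sub] .
  qed
  then have E: "|E| <o \<kappa>"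
    unfolding E_def by (intro small_UN_countable[OF \<kappa>])
  have "E \<subseteq> L" using BR B(2) Y' by (auto simp: E_def)
  define S0 where "S0 = E \<union> ((B [] - Z) \<union> (A [] - f ` Z))"
  have S0: "|S0| <o \<kappa>" "S0 \<subseteq> L"
    unfolding S0_def by (intro small_Un[OF inf] E Z(2,4)) (use \<open>E \<subseteq> L\<close> A(2) B(2) in blast)
  \<comment> \<open>Deleting \<open>S0\<close> alone could remove a point but not its image under
    \<open>f\<close>; the closure \<open>S\<close> deletes both or neither.\<close>
  have "Z \<subseteq> L" "f ` Z \<subseteq> L" using Z(1) Y' f A(2) B(2) by auto
  then obtain S where S: "S0 \<subseteq> S" "S \<subseteq> L" "|S| <o \<kappa>" "\<And>z. z \<in> Z \<Longrightarrow> f z \<in> S \<longleftrightarrow> z \<in> S"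
    using small_superset_closed_under_injection[OF \<kappa> Z(3) S0] by metis
  have "|branch_set A x - S| =o |branch_set B x - S|" for x
  proof -
    have mem: "f y \<in> branch_set A x \<longleftrightarrow> y \<in> branch_set B x" if "y \<in> Z" "y \<notin> S" for y
    proof -
      have "f y \<in> A \<sigma> \<longleftrightarrow> y \<in> B \<sigma>" for \<sigma>
        using that S(1) Z(1) by (auto simp: S0_def E_def)
      then show ?thesis by (simp add: mem_branch_set_iff)
    qed
    \<comment> \<open>\<open>S\<close> contains every point of the root outside \<open>Z\<close>, so
      \<open>f\<close> is controlled on all that remains.\<close>
    have BZ: "y \<in> Z" if "y \<in> branch_set B x - S" for y
      using that S(1) branch_set_subset_root[of B x] by (auto simp: S0_def)
    have "bij_betw f (branch_set B x - S) (branch_set A x - S)"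
      unfolding bij_betw_def
    proof
      show "inj_on f (branch_set B x - S)"
        using Z(3) BZ by (meson inj_on_subset subsetI)
      show "f ` (branch_set B x - S) = branch_set A x - S"
      proof
        show "f ` (branch_set B x - S) \<subseteq> branch_set A x - S"
          using BZ mem S(4) by blast
        show "branch_set A x - S \<subseteq> f ` (branch_set B x - S)"
        proof
          fix p assume p: "p \<in> branch_set A x - S"
          then have "p \<in> f ` Z"
            using S(1) branch_set_subset_root[of A x] by (auto simp: S0_def)
          then obtain y where "y \<in> Z" "p = f y" by blast
          then show "p \<in> f ` (branch_set B x - S)"
            using p mem S(4) by blast
        qed
      qed
    qed
    then show ?thesis
      using card_of_ordIsoI ordIso_symmetric by blast
  qed
  then show thesis
    using that S by blast
qed

section \<open>The equivalence for nice sequences\<close>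

lemma nice_representativesD:
  assumes "nice_representatives \<kappa> L \<A> A"
  shows "partition_tree A" "A [] \<subseteq> L"
  using assms by (auto simp: nice_representatives_def partition_tree_def)

theorem theorem5p3:
  fixes lam :: "'a rel" and \<kappa> :: "'k rel"
    and A B :: "bool list \<Rightarrow> 'a set"
    and \<A> \<B> :: "'a set set set"
  assumes "Card_order lam" and "Card_order \<kappa>" and "natLeq <o cf \<kappa>"
    and "countable_atomless_subalgebra (pow_mod \<kappa> (Field lam)) \<A>"
    and "countable_atomless_subalgebra (pow_mod \<kappa> (Field lam)) \<B>"
    and "nice_representatives \<kappa> (Field lam) \<A> A"
    and "nice_representatives \<kappa> (Field lam) \<B> B"
  shows "(\<exists>\<pi>. biso (pow_mod \<kappa> (A [])) (pow_mod \<kappa> (B [])) \<pi> \<and>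
              trivial_map \<kappa> (A []) (B []) \<pi> \<and>
              (\<forall>\<sigma>. \<pi> (cls \<kappa> (A []) (A \<sigma>)) = cls \<kappa> (B []) (B \<sigma>)))
     \<longleftrightarrow>
         ( |sym_diff (nonempty_branches A) (nonempty_branches B)| <o \<kappa> \<and>
          (\<exists>S \<subseteq> Field lam. |S| <o \<kappa> \<and>
             (\<forall>x. |branch_set A x - S| =o |branch_set B x - S| )))"
proof -
  note A = nice_representativesD[OF assms(6)] and B = nice_representativesD[OF assms(7)]
  have inf: "Cinfinite \<kappa>"
    using Cinfinite_if_natLeq_less natLeq_less_if_natLeq_less_cf assms(2,3) by blast
  show ?thesis (is "?iso \<longleftrightarrow> ?branches")
  proof
    assume ?iso
    then obtain \<pi> where "biso (pow_mod \<kappa> (A [])) (pow_mod \<kappa> (B [])) \<pi>"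
      "trivial_map \<kappa> (A []) (B []) \<pi>"
      "\<And>\<sigma>. \<pi> (cls \<kappa> (A []) (A \<sigma>)) = cls \<kappa> (B []) (B \<sigma>)"
      by blast
    from branches_equinumerous_off_small[OF assms(2,3) A B this]
    obtain S where S: "S \<subseteq> Field lam" "|S| <o \<kappa>"
      "\<And>x. |branch_set A x - S| =o |branch_set B x - S|"
      by metis
    \<comment> \<open>The bound on the symmetric difference is obtained from the equinumerous
      branches.\<close>
    then show ?branches
      using small_sym_diff_nonempty_branches[OF inf A(1) B(1) S(2,3)] by blast
  next
    assume ?branches
    then obtain S where S: "|S| <o \<kappa>" "\<And>x. |branch_set A x - S| =o |branch_set B x - S|"
      by blast
    obtain f where f: "bij_betw f (B [] - S) (A [] - S)"
      "\<And>y \<sigma>. y \<in> B [] - S \<Longrightarrow> f y \<in> A \<sigma> \<longleftrightarrow> y \<in> B \<sigma>"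
      using glue_branch_bijections[OF A(1) B(1) S(2)] by blast
    have small: "|C - (C - S)| <o \<kappa>" for C
      by (rule small_subset[OF S(1)]) blast
    obtain \<pi> where \<pi>: "biso (pow_mod \<kappa> (A [])) (pow_mod \<kappa> (B [])) \<pi>"
      "trivial_map \<kappa> (A []) (B []) \<pi>"
      "\<And>C. C \<subseteq> A [] \<Longrightarrow> \<pi> (cls \<kappa> (A []) C) = cls \<kappa> (B []) {y \<in> B [] - S. f y \<in> C}"
      using trivial_biso_of_almost_bijection[OF inf f(1) Diff_subset small Diff_subset small]
      by blast
    have "\<pi> (cls \<kappa> (A []) (A \<sigma>)) = cls \<kappa> (B []) (B \<sigma>)" for \<sigma>
    proof -
      have B\<sigma>: "B \<sigma> \<subseteq> B []" by (rule partition_tree_subset_root[OF B(1)])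
      \<comment> \<open>Since \<open>f\<close> respects nodes, the preimage of a node of
        \<open>A\<close> is the matching node of \<open>B\<close> up to points of
        \<open>S\<close>.\<close>
      then have "{y \<in> B [] - S. f y \<in> A \<sigma>} = B \<sigma> - S" using f(2) by auto
      then have "\<pi> (cls \<kappa> (A []) (A \<sigma>)) = cls \<kappa> (B []) (B \<sigma> - S)"
        using \<pi>(3)[OF partition_tree_subset_root[OF A(1)], of \<sigma>] by simp
      also have "\<dots> = cls \<kappa> (B []) (B \<sigma>)"
      proof (subst cls_eq_iff[OF inf])
        show "|sym_diff (B \<sigma> - S) (B \<sigma>)| <o \<kappa>"
          by (rule small_subset[OF S(1)]) blast
      qed (use B\<sigma> in blast)+
      finally show ?thesis .
    qed
    then show ?iso using \<pi> by blast
  qed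
qed

end
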